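(* Every pseudo-variety is an $R$-variety.
   Context: Let $\mathbb{N}$ be the set of nonnegative integers. A numerical semigroup is a subset $S\subseteq\mathbb{N}$ that is closed under addition, contains $0$, and has $\mathbb{N}\setminus S$ finite. For a numerical semigroup $S\neq\mathbb{N}$, $\mathrm{F}(S)=\max(\mathbb{N}\setminus S)$ is its Frobenius number (the greatest integer not in $S$). If $S\subsetneq T$ are numerical semigroups, $\mathrm{F}_T(S)=\max(T\setminus S)$ is the Frobenius number of $S$ restricted to $T$. A pseudo-variety is a non-empty family $\mathcal{P}$ of numerical semigroups such that: (1) $\mathcal{P}$ has a maximum element with respect to inclusion, denoted $\Delta(\mathcal{P})$; (2) if $S,T\in\mathcal{P}$ then $S\cap T\in\mathcal{P}$; (3) if $S\in\mathcal{P}$ and $S\neq\Delta(\mathcal{P})$ then $S\cup\{\mathrm{F}(S)\}\in\mathcal{P}$. An $R$-variety is a non-empty family $\mathcal{R}$ of numerical semigroups such that: (1) $\mathcal{R}$ has a maximum element with respect to inclusion, denoted $\Delta(\mathcal{R})$; (2) if $S,T\in\mathcal{R}$ then $S\cap T\in\mathcal{R}$; (3) if $S\in\mathcal{R}$ and $S\neq\Delta(\mathcal{R})$ then $S\cup\{\mathrm{F}_{\Delta(\mathcal{R})}(S)\}\in\mathcal{R}$. *)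

theory Defs
  imports Main
begin

definition numerical_semigroup :: "nat set \<Rightarrow> bool" where
  "numerical_semigroup S \<longleftrightarrow>
     0 \<in> S \<and> (\<forall>x\<in>S. \<forall>y\<in>S. x + y \<in> S) \<and> finite (UNIV - S)"

(* Meaningful only for a numerical semigroup S different from UNIV. *)
definition Frobenius :: "nat set \<Rightarrow> nat" where
  "Frobenius S = Max (UNIV - S)"

(* Frobenius number of S restricted to T; meaningful only for numerical
   semigroups S properly contained in T. *)
definition Frobenius_in :: "nat set \<Rightarrow> nat set \<Rightarrow> nat" where
  "Frobenius_in T S = Max (T - S)"

definition has_maximum :: "nat set set \<Rightarrow> bool" where
  "has_maximum F \<longleftrightarrow> (\<exists>D\<in>F. \<forall>S\<in>F. S \<subseteq> D)"

(* Maximum element with respect to inclusion; meaningful only if has_maximum F. *)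
definition Delta :: "nat set set \<Rightarrow> nat set" where
  "Delta F = (GREATEST D. D \<in> F)"

definition pseudo_variety :: "nat set set \<Rightarrow> bool" where
  "pseudo_variety P \<longleftrightarrow>
     P \<noteq> {} \<and> (\<forall>S\<in>P. numerical_semigroup S) \<and>
     has_maximum P \<and>
     (\<forall>S\<in>P. \<forall>T\<in>P. S \<inter> T \<in> P) \<and>
     (\<forall>S\<in>P. S \<noteq> Delta P \<longrightarrow> S \<union> {Frobenius S} \<in> P)"

definition R_variety :: "nat set set \<Rightarrow> bool" where
  "R_variety R \<longleftrightarrow>
     R \<noteq> {} \<and> (\<forall>S\<in>R. numerical_semigroup S) \<and>
     has_maximum R \<and>
     (\<forall>S\<in>R. \<forall>T\<in>R. S \<inter> T \<in> R) \<and>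
     (\<forall>S\<in>R. S \<noteq> Delta R \<longrightarrow> S \<union> {Frobenius_in (Delta R) S} \<in> R)"

end

theory Submission
  imports Defs
begin

text \<open>
  The two notions differ only in the gap that is adjoined to a member \<open>S \<noteq> \<Delta>\<close>: the largest gap
  of \<open>S\<close> in \<open>\<nat>\<close>, or the largest one inside \<open>\<Delta>\<close>. In a pseudo-variety these coincide. Indeed
  \<open>S \<union> {F(S)}\<close> again belongs to the family and hence lies below the maximum \<open>\<Delta>\<close>, so
  \<open>F(S) \<in> \<Delta> - S\<close>; being the largest of all gaps of \<open>S\<close>, it is then the largest one in \<open>\<Delta>\<close>
  (\<open>Frobenius_in_eq_Frobenius\<close>).
\<close>

lemma subset_Delta:
  assumes "has_maximum F" and "S \<in> F"
  shows "S \<subseteq> Delta F"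
proof -
  obtain D where D: "D \<in> F" "\<And>T. T \<in> F \<Longrightarrow> T \<subseteq> D"
    using assms(1) unfolding has_maximum_def by blast
  then have "Delta F = D"
    unfolding Delta_def by (intro Greatest_equality)
  with D(2) assms(2) show ?thesis by simp
qed

lemma Frobenius_notin:
  assumes "numerical_semigroup S" and "S \<noteq> UNIV"
  shows "Frobenius S \<notin> S"
proof -
  have "Max (UNIV - S) \<in> UNIV - S"
    using assms unfolding numerical_semigroup_def by (intro Max_in) auto
  then show ?thesis unfolding Frobenius_def by simp
qed

text \<open>
  The maximum of a finite set is also the maximum of every subset that contains it; here the
  subset \<open>T - S\<close> of the set of all gaps of \<open>S\<close>.
\<close>
lemma Frobenius_in_eq_Frobenius:
  assumes "numerical_semigroup S" and "S \<noteq> UNIV" and "Frobenius S \<in> T"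
  shows "Frobenius_in T S = Frobenius S"
proof -
  have fin: "finite (UNIV - S)"
    using assms(1) unfolding numerical_semigroup_def by blast
  show ?thesis
    unfolding Frobenius_in_def
  proof (rule Max_eqI)
    show "finite (T - S)"
      using fin by (rule rev_finite_subset) blast
    show "Frobenius S \<in> T - S"
      using assms Frobenius_notin by blast
    show "x \<le> Frobenius S" if "x \<in> T - S" for x
      using fin that unfolding Frobenius_def by (intro Max_ge) auto
  qed
qed

theorem proposition2p2:
  fixes P :: "nat set set"
  assumes "pseudo_variety P"
  shows "R_variety P"
proof -
  have max: "has_maximum P"
    and semigroup: "\<And>S. S \<in> P \<Longrightarrow> numerical_semigroup S"
    and adjoin: "\<And>S. S \<in> P \<Longrightarrow> S \<noteq> Delta P \<Longrightarrow> S \<union> {Frobenius S} \<in> P"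
    using assms unfolding pseudo_variety_def by blast+
  have "S \<union> {Frobenius_in (Delta P) S} \<in> P" if S: "S \<in> P" "S \<noteq> Delta P" for S
  proof -
    have "S \<noteq> UNIV"
      using subset_Delta[OF max S(1)] S(2) by blast
    moreover have "Frobenius S \<in> Delta P"
      using subset_Delta[OF max adjoin[OF S]] by blast
    ultimately have "Frobenius_in (Delta P) S = Frobenius S"
      using semigroup[OF S(1)] by (intro Frobenius_in_eq_Frobenius)
    with adjoin[OF S] show ?thesis by simp
  qed
  with assms show ?thesis
    unfolding pseudo_variety_def R_variety_def by blast
qed

end
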